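(* Let $\mathcal{V}$ be a semi-inner product space over $\mathbb{F}\in\{\mathbb{R},\mathbb{C}\}$. If $\mathcal{C}_\Phi=\mathscr{L}(\mathcal{V})$ (the set of all linear relations on $\mathcal{V}$), then the pair $(G,\mathcal{C}_\Phi)$ is interpolable for any $G\in\mathscr{R}(\mathcal{V})$.
   Context: $\mathbb{F}$ is the field of real or complex numbers; $X^*$ is the conjugate transpose. A semi-inner product space is a vector space $\mathcal{V}$ over $\mathbb{F}$ with a semi-inner product $\langle\cdot,\cdot\rangle$: it is linear in its second argument, satisfies $\langle x,y\rangle=\overline{\langle y,x\rangle}$, and $\langle x,x\rangle\ge 0$ for all $x$, but $\|x\|:=\sqrt{\langle x,x\rangle}=0$ need not imply $x=0$. A relation on $\mathcal{V}$ is a subset $R\subseteq\mathcal{V}\times\mathcal{V}$; $\mathscr{R}(\mathcal{V})$ is the set of all relations on $\mathcal{V}$. $\mathrm{dom}(R):=\{x\in\mathcal{V} : (x,y)\in R\text{ for some }y\in\mathcal{V}\}$. For $x\in\mathrm{dom}(R)$, $Rx$ denotes any $y\in\mathcal{V}$ with $(x,y)\in R$. Thus $y=Rx$ means $(x,y)\in R$, and a condition involving $\xi$ and $R\xi$ required for all $\xi\in\mathrm{dom}(R)$ is required for every pair $(\xi,\zeta)\in R$, with $\zeta$ in place of $R\xi$. A relation $R$ is linear if for all $(x_1,y_1),(x_2,y_2)\in R$ and all $\alpha_1,\alpha_2\in\mathbb{F}$, $(\alpha_1x_1+\alpha_2x_2,\ \alpha_1y_1+\alpha_2y_2)\in R$;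 $\mathscr{L}(\mathcal{V})\subseteq\mathscr{R}(\mathcal{V})$ is the set of all linear relations. Elements of $\mathcal{V}^2$ are augmented vectors $\begin{pmatrix}\xi_1\\ \xi_2\end{pmatrix}$ with $\xi_1,\xi_2\in\mathcal{V}$. For $M\in\mathbb{F}^{2\times2}$, $M\xi:=\begin{pmatrix}M_{11}\xi_1+M_{12}\xi_2\\ M_{21}\xi_1+M_{22}\xi_2\end{pmatrix}$. On $\mathcal{V}^2$, $\langle\xi,\zeta\rangle:=\langle\xi_1,\zeta_1\rangle+\langle\xi_2,\zeta_2\rangle$ and $\|\xi\|:=\sqrt{\langle\xi,\xi\rangle}$. For relations $G,\Phi$ on $\mathcal{V}$, the closed-loop relation $R_{uy}$ is the set of $(u,y)\in\mathcal{V}^2\times\mathcal{V}^2$ for which there exists $e\in\mathcal{V}^2$ with $e_1=u_1+y_2$, $y_2=\Phi e_2$, $e_2=u_2+y_1$, $y_1=Ge_1$. For $G\in\mathscr{R}(\mathcal{V})$, $\mathcal{C}_\Phi\subseteq\mathscr{R}(\mathcal{V})$ and $M=M^*\in\mathbb{F}^{2\times2}$, consider the statements: (ii) There exists $\gamma>0$ such that for all $u,y,e\in\mathcal{V}^2$: if $\left\langle \begin{pmatrix} e_2\\ y_2\end{pmatrix}, M\begin{pmatrix} e_2\\ y_2\end{pmatrix}\right\rangle\ge 0$ and $e_1=u_1+y_2$, $e_2=u_2+y_1$, $y_1=Ge_1$ hold, then $\|y\|\le\gamma\|u\|$. (iii) There exists $\gamma>0$ such that for all $\Phi\in\mathcal{C}_\Phi$: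 if $\left\langle \begin{pmatrix} \xi\\ \Phi\xi\end{pmatrix}, M\begin{pmatrix} \xi\\ \Phi\xi\end{pmatrix}\right\rangle\ge 0$ for all $\xi\in\mathrm{dom}(\Phi)$, then $\|y\|\le\gamma\|u\|$ for all $(u,y)\in R_{uy}$. The pair $(G,\mathcal{C}_\Phi)$ is called interpolable if (iii) $\implies$ (ii) holds (for every $M=M^*\in\mathbb{F}^{2\times 2}$). *)

theory Defs
  imports "HOL-Analysis.Analysis" "Jordan_Normal_Form.Conjugate"
begin

text \<open>
  The definitions are polymorphic in the scalar type and are meant to be used at
  \<^typ>\<open>real\<close> (where \<^const>\<open>conjugate\<close> is the identity) and at \<^typ>\<open>complex\<close>
  (where it is \<^const>\<open>cnj\<close>, and \<open>0 \<le> z\<close> means that \<open>z\<close> is real and nonnegative).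
\<close>

locale semi_inner_product_space = vector_space smul
  for smul :: "'f::{conjugatable_ordered_field, real_normed_field} \<Rightarrow> 'v::ab_group_add \<Rightarrow> 'v" +
  fixes ip :: "'v \<Rightarrow> 'v \<Rightarrow> 'f"
  assumes ip_linear_right:
      "ip x (smul a y + smul b z) = a * ip x y + b * ip x z"
    and ip_conjugate: "ip x y = conjugate (ip y x)"
    and ip_nonneg: "ip x x \<ge> 0"

text \<open>The scalar \<open>ip x x\<close> is nonnegative, so \<^const>\<open>norm\<close> only converts it to type \<^typ>\<open>real\<close>.\<close>

definition seminorm_of :: "('v \<Rightarrow> 'v \<Rightarrow> 'f::real_normed_field) \<Rightarrow> 'v \<Rightarrow> real" where
  "seminorm_of ip x = sqrt (norm (ip x x))"

definition linear_relation :: "('f \<Rightarrow> 'v::plus \<Rightarrow> 'v) \<Rightarrow> ('v \<times> 'v) set \<Rightarrow> bool" where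
  "linear_relation smul R \<longleftrightarrow>
     (\<forall>x1 y1 x2 y2 a1 a2. (x1, y1) \<in> R \<longrightarrow> (x2, y2) \<in> R \<longrightarrow>
        (smul a1 x1 + smul a2 x2, smul a1 y1 + smul a2 y2) \<in> R)"

definition aug_ip :: "('v \<Rightarrow> 'v \<Rightarrow> 'f::plus) \<Rightarrow> 'v \<times> 'v \<Rightarrow> 'v \<times> 'v \<Rightarrow> 'f" where
  "aug_ip ip \<xi> \<zeta> = ip (fst \<xi>) (fst \<zeta>) + ip (snd \<xi>) (snd \<zeta>)"

definition aug_mult :: "('f \<Rightarrow> 'v::plus \<Rightarrow> 'v) \<Rightarrow> 'f^2^2 \<Rightarrow> 'v \<times> 'v \<Rightarrow> 'v \<times> 'v" where
  "aug_mult smul M \<xi> =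
     (smul (M $ 1 $ 1) (fst \<xi>) + smul (M $ 1 $ 2) (snd \<xi>),
      smul (M $ 2 $ 1) (fst \<xi>) + smul (M $ 2 $ 2) (snd \<xi>))"

definition conjugate_transpose :: "'f::conjugate^'n^'m \<Rightarrow> 'f^'m^'n" where
  "conjugate_transpose X = (\<chi> i j. conjugate (X $ j $ i))"

definition closed_loop ::
  "('v \<times> 'v) set \<Rightarrow> ('v \<times> 'v) set \<Rightarrow> (('v::plus \<times> 'v) \<times> ('v \<times> 'v)) set" where
  "closed_loop G \<Phi> = {(u, y). \<exists>e.
     fst e = fst u + snd y \<and> (snd e, snd y) \<in> \<Phi> \<and>
     snd e = snd u + fst y \<and> (fst e, fst y) \<in> G}"

definition graph_separation ::
  "('f::{ord,real_normed_field} \<Rightarrow> 'v::plus \<Rightarrow> 'v) \<Rightarrow> ('v \<Rightarrow> 'v \<Rightarrow> 'f) \<Rightarrow>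
   ('v \<times> 'v) set \<Rightarrow> 'f^2^2 \<Rightarrow> bool" where
  "graph_separation smul ip G M \<longleftrightarrow>
     (\<exists>\<gamma>::real. \<gamma> > 0 \<and> (\<forall>u y e.
        aug_ip ip (snd e, snd y) (aug_mult smul M (snd e, snd y)) \<ge> 0 \<longrightarrow>
        fst e = fst u + snd y \<longrightarrow> snd e = snd u + fst y \<longrightarrow> (fst e, fst y) \<in> G \<longrightarrow>
        seminorm_of (aug_ip ip) y \<le> \<gamma> * seminorm_of (aug_ip ip) u))"

definition robust_stability ::
  "('f::{ord,real_normed_field} \<Rightarrow> 'v::plus \<Rightarrow> 'v) \<Rightarrow> ('v \<Rightarrow> 'v \<Rightarrow> 'f) \<Rightarrow>
   ('v \<times> 'v) set \<Rightarrow> ('v \<times> 'v) set set \<Rightarrow> 'f^2^2 \<Rightarrow> bool" where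
  "robust_stability smul ip G C M \<longleftrightarrow>
     (\<exists>\<gamma>::real. \<gamma> > 0 \<and> (\<forall>\<Phi>\<in>C.
        (\<forall>(\<xi>, \<zeta>)\<in>\<Phi>. aug_ip ip (\<xi>, \<zeta>) (aug_mult smul M (\<xi>, \<zeta>)) \<ge> 0) \<longrightarrow>
        (\<forall>(u, y)\<in>closed_loop G \<Phi>.
           seminorm_of (aug_ip ip) y \<le> \<gamma> * seminorm_of (aug_ip ip) u)))"

definition interpolable ::
  "('f::{ord,conjugate,real_normed_field} \<Rightarrow> 'v::plus \<Rightarrow> 'v) \<Rightarrow> ('v \<Rightarrow> 'v \<Rightarrow> 'f) \<Rightarrow>
   ('v \<times> 'v) set \<Rightarrow> ('v \<times> 'v) set set \<Rightarrow> bool" where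
  "interpolable smul ip G C \<longleftrightarrow>
     (\<forall>M. M = conjugate_transpose M \<longrightarrow>
        robust_stability smul ip G C M \<longrightarrow> graph_separation smul ip G M)"

end

theory Submission
  imports Defs
begin

text \<open>
  The constraint in the graph separation condition concerns one vector
  \<open>(e\<^sub>2, y\<^sub>2)\<close> at a time, whereas robust stability speaks of whole relations
  \<open>\<Phi>\<close>; lines bridge the gap. If \<open>(e\<^sub>2, y\<^sub>2)\<close> satisfies the quadratic
  inequality given by \<open>M\<close>, then so does each of its scalar multiples, because scaling by
  \<open>a\<close> multiplies the quadratic form by \<open>conjugate a * a \<ge> 0\<close>
  (\<open>aug_quadratic_form_scale\<close>). The multiples of \<open>(e\<^sub>2, y\<^sub>2)\<close> form a linear
  relation \<open>\<Phi>\<close> (\<open>linear_relation_line\<close>), and since \<open>\<Phi>\<close> passes through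
  \<open>(e\<^sub>2, y\<^sub>2)\<close> itself, the given signals \<open>(u, y)\<close> belong to the closed loop of
  \<open>G\<close> and \<open>\<Phi>\<close>. The gain bound \<open>\<gamma>\<close> of robust stability is uniform in
  \<open>\<Phi>\<close>, so the same \<open>\<gamma>\<close> works for graph separation although the line
  changes with the signals.
\<close>

context semi_inner_product_space
begin

lemma ip_add_right: "ip x (y + z) = ip x y + ip x z"
  using ip_linear_right[of x 1 y 1 z] by simp

lemma ip_scale_right: "ip x (smul a y) = a * ip x y"
  using ip_linear_right[of x a y 0 y] by simp

lemma ip_scale_left: "ip (smul a x) y = conjugate a * ip x y"
proof -
  have "ip (smul a x) y = conjugate (a * ip y x)"
    by (subst ip_conjugate) (simp only: ip_scale_right)
  also have "\<dots> = conjugate a * conjugate (ip y x)"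
    by (rule conjugate_dist_mul)
  also have "conjugate (ip y x) = ip x y"
    by (rule ip_conjugate[symmetric])
  finally show ?thesis .
qed

lemma aug_quadratic_form_scale:
  "aug_ip ip (smul a x, smul a y) (aug_mult smul M (smul a x, smul a y)) =
     conjugate a * a * aug_ip ip (x, y) (aug_mult smul M (x, y))"
  by (simp add: aug_ip_def aug_mult_def ip_add_right ip_scale_right ip_scale_left algebra_simps
      del: scale_scale)

lemma linear_relation_line: "linear_relation smul (range (\<lambda>a. (smul a x, smul a y)))"
  unfolding linear_relation_def
  by (auto simp flip: scale_left_distrib)

end

text \<open>
  The order of a \<^class>\<open>conjugatable_ordered_field\<close> is compatible with addition only; the
  class \<^class>\<open>ordered_comm_ring\<close>, which contains both the reals and the complex numbers,
  supplies that products of nonnegative scalars are nonnegative.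
\<close>

lemma aug_quadratic_form_scale_nonneg:
  fixes smul :: "'f::{conjugatable_ordered_field, ordered_comm_ring, real_normed_field}
      \<Rightarrow> 'v::ab_group_add \<Rightarrow> 'v"
  assumes "semi_inner_product_space smul ip"
    and "aug_ip ip (x, y) (aug_mult smul M (x, y)) \<ge> 0"
  shows "aug_ip ip (smul a x, smul a y) (aug_mult smul M (smul a x, smul a y)) \<ge> 0"
proof -
  have "conjugate a * a \<ge> 0"
    using conjugate_square_positive[of a] by (simp add: mult.commute)
  with assms(2) show ?thesis
    unfolding semi_inner_product_space.aug_quadratic_form_scale[OF assms(1)]
    by (simp add: mult_nonneg_nonneg)
qed

theorem interpolable_linear_relations:
  fixes smul :: "'f::{conjugatable_ordered_field, ordered_comm_ring, real_normed_field}
      \<Rightarrow> 'v::ab_group_add \<Rightarrow> 'v"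
  assumes "semi_inner_product_space smul ip"
  shows "interpolable smul ip G {R. linear_relation smul R}"
  unfolding interpolable_def
proof (intro allI impI)
  interpret semi_inner_product_space smul ip by (rule assms)
  fix M
  assume "robust_stability smul ip G {R. linear_relation smul R} M"
  then obtain \<gamma> where "\<gamma> > 0" and robust:
    "\<And>\<Phi> u y. linear_relation smul \<Phi> \<Longrightarrow>
       (\<forall>(\<xi>, \<zeta>)\<in>\<Phi>. aug_ip ip (\<xi>, \<zeta>) (aug_mult smul M (\<xi>, \<zeta>)) \<ge> 0) \<Longrightarrow>
       (u, y) \<in> closed_loop G \<Phi> \<Longrightarrow>
       seminorm_of (aug_ip ip) y \<le> \<gamma> * seminorm_of (aug_ip ip) u"
    unfolding robust_stability_def by fast
  have "seminorm_of (aug_ip ip) y \<le> \<gamma> * seminorm_of (aug_ip ip) u"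
    if nonneg: "aug_ip ip (snd e, snd y) (aug_mult smul M (snd e, snd y)) \<ge> 0"
      and loop: "fst e = fst u + snd y" "snd e = snd u + fst y" "(fst e, fst y) \<in> G"
    for u y e
  proof -
    define \<Phi> where "\<Phi> = range (\<lambda>a. (smul a (snd e), smul a (snd y)))"
    have linear: "linear_relation smul \<Phi>"
      unfolding \<Phi>_def by (rule linear_relation_line)
    have quadratic: "\<forall>(\<xi>, \<zeta>)\<in>\<Phi>. aug_ip ip (\<xi>, \<zeta>) (aug_mult smul M (\<xi>, \<zeta>)) \<ge> 0"
      using aug_quadratic_form_scale_nonneg[OF assms nonneg] by (auto simp: \<Phi>_def)
    have "(snd e, snd y) \<in> \<Phi>"
      unfolding \<Phi>_def by (rule range_eqI[where x = 1]) simp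
    with loop have "(u, y) \<in> closed_loop G \<Phi>"
      unfolding closed_loop_def by blast
    with linear quadratic show ?thesis by (rule robust)
  qed
  with \<open>\<gamma> > 0\<close> show "graph_separation smul ip G M"
    unfolding graph_separation_def by blast
qed

theorem theorem9:
  fixes smulR :: "real \<Rightarrow> 'v::ab_group_add \<Rightarrow> 'v" and ipR :: "'v \<Rightarrow> 'v \<Rightarrow> real"
    and smulC :: "complex \<Rightarrow> 'w::ab_group_add \<Rightarrow> 'w" and ipC :: "'w \<Rightarrow> 'w \<Rightarrow> complex"
  shows "(semi_inner_product_space smulR ipR \<longrightarrow>
            (\<forall>G. interpolable smulR ipR G {R. linear_relation smulR R})) \<and>
         (semi_inner_product_space smulC ipC \<longrightarrow>
            (\<forall>G. interpolable smulC ipC G {R. linear_relation smulC R}))"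
  by (blast intro: interpolable_linear_relations)

end
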